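(* Let $F$ be a clause set. If the reasoning algorithm with inference rules A1, A2, and A3, started from $\mathcal{S}_0=\{F\}$, yields a complete and clash-free family of clause sets $\mathcal{S}_n$, then $F$ is satisfiable.
   Context: $\mathcal{ALC}$ interpretations $\mathcal{I}=(\Delta^\mathcal{I},\cdot^\mathcal{I})$ with the standard semantics of $\lnot,\sqcap,\sqcup,\forall R.,\exists R.$. Conjunctive normal forms are defined by mutual induction: a concept literal is $A$, $\lnot A$ ($A$ a concept name), $\exists R.F$ or $\forall R.F$ ($R$ a role name, $F$ a conjunctive normal form); a clause is a finite disjunction of concept literals, represented as a set of literals; a conjunctive normal form is a finite conjunction of clauses, represented as a clause set. A clause set $F$ denotes the conjunction of its clauses, each clause the disjunction of its literals; $F$ is satisfiable if $F^\mathcal{I}\neq\emptyset$ for some interpretation $\mathcal{I}$. The complementary literal $\overline{L}$ is: $\overline{A}=\lnot A$, $\overline{\lnot A}=A$, $\overline{\exists R.F}=\forall R.\mathrm{CNF}(\lnot F)$, $\overline{\forall R.F}=\exists R.\mathrm{CNF}(\lnot F)$, with $\mathrm{CNF}(C)$ the equivalent conjunctive normal form of $C$ (push negations inward, distribute $\sqcup$ over $\sqcap$, flatten). A derivation works on families of clause sets $\mathcal{S}_i$, starting with $\mathcal{S}_0=\{F\}$; $\mathcal{S}_{i+1}$ is obtained from $\mathcal{S}_i$ by applying one of the following rules to a clause set $F\in\mathcal{S}_i$: (A1) if $L\in CL$ for a clause $CL\in F$: replace $CL$ by $\{L\}$ (nondeterministic choice of $L$). (A2) if $\forall R.F_1\in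 CL$ for some clause $CL\in F$: remove from $F$ all clauses containing $\forall R.F_1$, and replace every literal $\exists R.F_2$ occurring in clauses of $F$ by $\exists R.(F_1\cup F_2)$. (A3) if all clauses of $F$ are unit clauses of the form $\{A\}$, $\{\lnot A\}$ or $\{\exists R.F'\}$: for some $\{\exists R.F_1\}\in F$, replace $F$ by $F\setminus\{\{\exists R.F_1\}\}$ and add $F_1$ to the family ($F$ is the parent of $F_1$ with respect to $R$). A family is complete if no rule is applicable to it. It is clash-free if no clause set in it contains the empty clause or contains both $\{L\}$ and $\{\overline{L}\}$ for some literal $L$. *)

theory Defs
  imports Main "HOL-Library.FSet"
begin

text \<open>Conjunction and disjunction of concepts are finitary; the empty conjunction is the top
  concept and the empty disjunction the bottom concept.\<close>

datatype ('c, 'r) concept =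
    Name 'c
  | Neg "('c, 'r) concept"
  | And "('c, 'r) concept fset"
  | Or "('c, 'r) concept fset"
  | Exists 'r "('c, 'r) concept"
  | Forall 'r "('c, 'r) concept"

record ('c, 'r, 'd) interp =
  domain :: "'d set"
  conc :: "'c \<Rightarrow> 'd set"
  rol :: "'r \<Rightarrow> ('d \<times> 'd) set"

definition is_interp :: "('c, 'r, 'd) interp \<Rightarrow> bool" where
  "is_interp I \<longleftrightarrow>
     domain I \<noteq> {} \<and> (\<forall>A. conc I A \<subseteq> domain I) \<and> (\<forall>R. rol I R \<subseteq> domain I \<times> domain I)"

primrec sem :: "('c, 'r, 'd) interp \<Rightarrow> ('c, 'r) concept \<Rightarrow> 'd set" where
  "sem I (Name A) = conc I A"
| "sem I (Neg C) = domain I - sem I C"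
| "sem I (And X) = domain I \<inter> \<Inter> (fset (sem I |`| X))"
| "sem I (Or X) = \<Union> (fset (sem I |`| X))"
| "sem I (Exists R C) = {d \<in> domain I. \<exists>e. (d, e) \<in> rol I R \<and> e \<in> sem I C}"
| "sem I (Forall R C) = {d \<in> domain I. \<forall>e. (d, e) \<in> rol I R \<longrightarrow> e \<in> sem I C}"

datatype ('c, 'r) literal =
    LPos 'c
  | LNeg 'c
  | LEx 'r "('c, 'r) literal fset fset"
  | LAll 'r "('c, 'r) literal fset fset"

type_synonym ('c, 'r) clause = "('c, 'r) literal fset"
type_synonym ('c, 'r) clause_set = "('c, 'r) clause fset"

primrec concept_of_literal :: "('c, 'r) literal \<Rightarrow> ('c, 'r) concept" where
  "concept_of_literal (LPos A) = Name A"
| "concept_of_literal (LNeg A) = Neg (Name A)"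
| "concept_of_literal (LEx R F) = Exists R (And (Or |`| (fimage concept_of_literal |`| F)))"
| "concept_of_literal (LAll R F) = Forall R (And (Or |`| (fimage concept_of_literal |`| F)))"

definition concept_of_clause :: "('c, 'r) clause \<Rightarrow> ('c, 'r) concept" where
  "concept_of_clause CL = Or (concept_of_literal |`| CL)"

definition concept_of :: "('c, 'r) clause_set \<Rightarrow> ('c, 'r) concept" where
  "concept_of F = And (concept_of_clause |`| F)"

text \<open>HOL cannot quantify existentially over the type of domain elements. Domains are arbitrary
  nonempty subsets of \<^typ>\<open>nat\<close>; since a concept mentions only finitely many names, by
  the downward Loewenheim-Skolem theorem this is equivalent to satisfiability over domains of
  arbitrary cardinality.\<close>

definition satisfiable :: "('c, 'r) clause_set \<Rightarrow> bool" where
  "satisfiable F \<longleftrightarrow>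
     (\<exists>I :: ('c, 'r, nat) interp. is_interp I \<and> sem I (concept_of F) \<noteq> {})"

text \<open>The clauses of \<open>distribute X\<close> are the unions of one clause chosen from each member of
  \<open>X\<close>; this is the flattened result of distributing disjunction over conjunction in the
  disjunction of the conjunctive normal forms in \<open>X\<close>.\<close>

definition distribute :: "('c, 'r) clause_set fset \<Rightarrow> ('c, 'r) clause_set" where
  "distribute X = ffilter
     (\<lambda>D. \<exists>f. (\<forall>G |\<in>| X. f G |\<in>| G) \<and> D = ffUnion (f |`| X)) (fPow (ffUnion (ffUnion X)))"

text \<open>\<open>cnf_pol C True\<close> is the normal form of \<open>C\<close> and \<open>cnf_pol C False\<close>
  that of its negation: negations are pushed inward by flipping the polarity.\<close>

primrec cnf_pol :: "('c, 'r) concept \<Rightarrow> bool \<Rightarrow> ('c, 'r) clause_set" where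
  "cnf_pol (Name A) b = {|{|if b then LPos A else LNeg A|}|}"
| "cnf_pol (Neg C) b = cnf_pol C (\<not> b)"
| "cnf_pol (And X) b =
     (if b then ffUnion ((\<lambda>C. cnf_pol C b) |`| X) else distribute ((\<lambda>C. cnf_pol C b) |`| X))"
| "cnf_pol (Or X) b =
     (if b then distribute ((\<lambda>C. cnf_pol C b) |`| X) else ffUnion ((\<lambda>C. cnf_pol C b) |`| X))"
| "cnf_pol (Exists R C) b = {|{|(if b then LEx else LAll) R (cnf_pol C b)|}|}"
| "cnf_pol (Forall R C) b = {|{|(if b then LAll else LEx) R (cnf_pol C b)|}|}"

definition cnf :: "('c, 'r) concept \<Rightarrow> ('c, 'r) clause_set" where
  "cnf C = cnf_pol C True"

fun complement :: "('c, 'r) literal \<Rightarrow> ('c, 'r) literal" where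
  "complement (LPos A) = LNeg A"
| "complement (LNeg A) = LPos A"
| "complement (LEx R F) = LAll R (cnf (Neg (concept_of F)))"
| "complement (LAll R F) = LEx R (cnf (Neg (concept_of F)))"

lemma concept_of_literal_quant:
  "concept_of_literal (LEx R F) = Exists R (concept_of F)"
  "concept_of_literal (LAll R F) = Forall R (concept_of F)"
  by (simp_all add: concept_of_def concept_of_clause_def[abs_def] fset.map_comp comp_def)

lemma sem_subset_domain: "is_interp I \<Longrightarrow> sem I C \<subseteq> domain I"
  by (induction C) (auto simp: is_interp_def)

lemma sem_concept_of:
  "d \<in> sem I (concept_of F) \<longleftrightarrow>
     d \<in> domain I \<and> (\<forall>CL |\<in>| F. \<exists>L |\<in>| CL. d \<in> sem I (concept_of_literal L))"
  by (auto simp: concept_of_def concept_of_clause_def)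

lemma fmember_ffUnion_iff: "x |\<in>| ffUnion X \<longleftrightarrow> (\<exists>G |\<in>| X. x |\<in>| G)"
  by (simp add: ffUnion.rep_eq)

lemma fmember_distribute:
  "D |\<in>| distribute X \<longleftrightarrow> (\<exists>f. (\<forall>G |\<in>| X. f G |\<in>| G) \<and> D = ffUnion (f |`| X))"
proof -
  have "ffUnion (f |`| X) |\<subseteq>| ffUnion (ffUnion X)" if "\<forall>G |\<in>| X. f G |\<in>| G" for f
    using that by (fastforce simp: fmember_ffUnion_iff)
  then show ?thesis by (auto simp: distribute_def)
qed

lemma sem_distribute:
  assumes "d \<in> domain I"
  shows "d \<in> sem I (concept_of (distribute X)) \<longleftrightarrow> (\<exists>G |\<in>| X. d \<in> sem I (concept_of G))"
proof
  let ?t = "\<lambda>CL. \<exists>L |\<in>| CL. d \<in> sem I (concept_of_literal L)"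
  assume *: "d \<in> sem I (concept_of (distribute X))"
  show "\<exists>G |\<in>| X. d \<in> sem I (concept_of G)"
  proof (rule ccontr)
    assume "\<not> ?thesis"
    then have "\<forall>G. \<exists>CL. G |\<in>| X \<longrightarrow> CL |\<in>| G \<and> \<not> ?t CL"
      using assms by (auto simp: sem_concept_of)
    then obtain f where f: "\<And>G. G |\<in>| X \<Longrightarrow> f G |\<in>| G \<and> \<not> ?t (f G)" by metis
    then have "ffUnion (f |`| X) |\<in>| distribute X" by (auto simp: fmember_distribute)
    then have "?t (ffUnion (f |`| X))" using * unfolding sem_concept_of by blast
    then show False using f by (auto simp: fmember_ffUnion_iff)
  qed
next
  assume "\<exists>G |\<in>| X. d \<in> sem I (concept_of G)"
  then show "d \<in> sem I (concept_of (distribute X))"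
    using assms by (fastforce simp: sem_concept_of fmember_distribute fmember_ffUnion_iff)
qed

lemma sem_ffUnion:
  assumes "d \<in> domain I"
  shows "d \<in> sem I (concept_of (ffUnion X)) \<longleftrightarrow> (\<forall>G |\<in>| X. d \<in> sem I (concept_of G))"
  using assms by (auto simp: sem_concept_of fmember_ffUnion_iff)

lemma sem_unit:
  "d \<in> sem I (concept_of {|{|L|}|}) \<longleftrightarrow> d \<in> domain I \<and> d \<in> sem I (concept_of_literal L)"
  by (simp add: sem_concept_of)

lemma sem_cnf_pol:
  assumes I: "is_interp I"
  shows "d \<in> domain I \<Longrightarrow> d \<in> sem I (concept_of (cnf_pol C b)) \<longleftrightarrow> (d \<in> sem I C \<longleftrightarrow> b)"
proof (induction C arbitrary: d b)
  case (Exists R C)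
  have "e \<in> domain I" if "(d, e) \<in> rol I R" for e
    using that I by (auto simp: is_interp_def)
  with Exists show ?case
    by (cases b) (auto simp: sem_unit concept_of_literal_quant simp del: concept_of_literal.simps(3,4))
next
  case (Forall R C)
  have "e \<in> domain I" if "(d, e) \<in> rol I R" for e
    using that I by (auto simp: is_interp_def)
  with Forall show ?case
    by (cases b) (auto simp: sem_unit concept_of_literal_quant simp del: concept_of_literal.simps(3,4))
qed (auto simp: sem_unit sem_distribute sem_ffUnion)

lemma sem_cnf:
  assumes "is_interp I"
  shows "sem I (concept_of (cnf C)) = sem I C"
  using sem_cnf_pol[OF assms, of _ C True] sem_subset_domain[OF assms]
  unfolding cnf_def by blast

text \<open>Only literals at the top level of a clause are affected, since the universal restriction
  concerns the role successors of the current element.\<close>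

fun add_to_ex :: "'r \<Rightarrow> ('c, 'r) clause_set \<Rightarrow> ('c, 'r) literal \<Rightarrow> ('c, 'r) literal" where
  "add_to_ex R F\<^sub>1 (LEx R' F\<^sub>2) = (if R' = R then LEx R (F\<^sub>1 |\<union>| F\<^sub>2) else LEx R' F\<^sub>2)"
| "add_to_ex R F\<^sub>1 L = L"

text \<open>In \<open>A1\<close> the premise \<open>CL \<noteq> {|L|}\<close> excludes the trivial replacement of a unit
  clause by itself, which would otherwise make the rule applicable forever; the other two rules
  always change the clause set. The parent relation recorded by \<open>A3\<close> does not influence
  the rules and is left out.\<close>

inductive step :: "('c, 'r) clause_set set \<Rightarrow> ('c, 'r) clause_set set \<Rightarrow> bool" where
  A1: "F \<in> S \<Longrightarrow> CL |\<in>| F \<Longrightarrow> L |\<in>| CL \<Longrightarrow> CL \<noteq> {|L|} \<Longrightarrow>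
    step S (insert (finsert {|L|} (F |-| {|CL|})) (S - {F}))"
| A2: "F \<in> S \<Longrightarrow> CL |\<in>| F \<Longrightarrow> LAll R F\<^sub>1 |\<in>| CL \<Longrightarrow>
    step S (insert (fimage (add_to_ex R F\<^sub>1) |`| ffilter (\<lambda>D. LAll R F\<^sub>1 |\<notin>| D) F) (S - {F}))"
| A3: "F \<in> S \<Longrightarrow>
    \<forall>D |\<in>| F. (\<exists>A. D = {|LPos A|}) \<or> (\<exists>A. D = {|LNeg A|}) \<or> (\<exists>R' F'. D = {|LEx R' F'|}) \<Longrightarrow>
    {|LEx R F\<^sub>1|} |\<in>| F \<Longrightarrow>
    step S (insert (F |-| {|{|LEx R F\<^sub>1|}|}) (insert F\<^sub>1 (S - {F})))"

definition complete_family :: "('c, 'r) clause_set set \<Rightarrow> bool" where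
  "complete_family S \<longleftrightarrow> \<not> (\<exists>S'. step S S')"

definition clash_free :: "('c, 'r) clause_set set \<Rightarrow> bool" where
  "clash_free S \<longleftrightarrow>
     (\<forall>F \<in> S. {||} |\<notin>| F \<and> \<not> (\<exists>L. {|L|} |\<in>| F \<and> {|complement L|} |\<in>| F))"

end

theory Submission
  imports Defs
begin

text \<open>Read backwards, every rule turns a family of satisfiable clause sets into a family of
  satisfiable clause sets, and the members of a complete and clash-free family consist of
  consistent unit literals only. The rules \<open>A2\<close> and \<open>A3\<close> are invertible because
  every satisfiable clause set holds at a root without incoming edges: edges leaving such a root
  can be deleted or added without affecting the concepts that hold at its successors.\<close>

section \<open>Invariance of the semantics under bounded morphisms\<close>

lemma is_interpD:
  assumes "is_interp I"
  shows "d \<in> conc I A \<Longrightarrow> d \<in> domain I"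
    and "(d, e) \<in> rol I R \<Longrightarrow> d \<in> domain I" and "(d, e) \<in> rol I R \<Longrightarrow> e \<in> domain I"
  using assms by (auto simp: is_interp_def)

text \<open>The hypothesis \<open>rol\<close> combines the forth and back conditions, so the graph
  of \<open>f\<close> is a bisimulation and the claim follows by induction on \<open>C\<close>. It
  serves to transfer truth along the embeddings \<open>Suc\<close>, \<open>2 * d\<close> and
  \<open>2 * d + 1\<close> below.\<close>

lemma sem_bounded_morphism:
  assumes I: "is_interp I"
    and dom: "\<And>d. d \<in> domain I \<Longrightarrow> f d \<in> domain J"
    and conc: "\<And>d A. d \<in> domain I \<Longrightarrow> f d \<in> conc J A \<longleftrightarrow> d \<in> conc I A"
    and rol: "\<And>d R. d \<in> domain I \<Longrightarrow> rol J R `` {f d} = f ` (rol I R `` {d})"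
  shows "d \<in> domain I \<Longrightarrow> f d \<in> sem J C \<longleftrightarrow> d \<in> sem I C"
proof -
  have rol': "(f d, e') \<in> rol J R \<longleftrightarrow> (\<exists>e. e' = f e \<and> (d, e) \<in> rol I R)"
    if "d \<in> domain I" for d e' R
    using rol[OF that, of R] by blast
  show "d \<in> domain I \<Longrightarrow> ?thesis"
  proof (induction C arbitrary: d)
    case (Exists R C)
    have "f e \<in> sem J C \<longleftrightarrow> e \<in> sem I C" if "(d, e) \<in> rol I R" for e
      using Exists.IH is_interpD(3)[OF I that] by blast
    then show ?case using Exists.prems by (auto simp: dom rol')
  next
    case (Forall R C)
    have "f e \<in> sem J C \<longleftrightarrow> e \<in> sem I C" if "(d, e) \<in> rol I R" for e
      using Forall.IH is_interpD(3)[OF I that] by blast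
    then show ?case using Forall.prems by (auto simp: dom rol')
  next
    case (And X)
    then show ?case by (simp add: dom)
  next
    case (Or X)
    then show ?case by simp
  qed (simp_all add: dom conc)
qed

section \<open>Interpretations with a fresh root\<close>

text \<open>Truth of a literal at a virtual element outside \<open>I\<close> with names
  \<open>V\<close> and successors \<open>E\<close>. Keeping this element apart allows
  \<open>V\<close> and \<open>E\<close> to vary while the concepts at the successors stay
  fixed.\<close>

primrec root_sat ::
  "('c, 'r, 'd) interp \<Rightarrow> 'c set \<Rightarrow> ('r \<Rightarrow> 'd set) \<Rightarrow> ('c, 'r) literal \<Rightarrow> bool" where
  "root_sat I V E (LPos A) \<longleftrightarrow> A \<in> V"
| "root_sat I V E (LNeg A) \<longleftrightarrow> A \<notin> V"
| "root_sat I V E (LEx R G) \<longleftrightarrow> (\<exists>e \<in> E R. e \<in> sem I (concept_of G))"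
| "root_sat I V E (LAll R G) \<longleftrightarrow> (\<forall>e \<in> E R. e \<in> sem I (concept_of G))"

text \<open>The shift by \<open>Suc\<close> frees 0 for the root and keeps the domain inside
  \<open>nat\<close>.\<close>

definition add_root ::
  "('c, 'r, nat) interp \<Rightarrow> 'c set \<Rightarrow> ('r \<Rightarrow> nat set) \<Rightarrow> ('c, 'r, nat) interp" where
  "add_root I V E = \<lparr>
     domain = insert 0 (Suc ` domain I),
     conc = \<lambda>A. Suc ` conc I A \<union> {d. d = 0 \<and> A \<in> V},
     rol = \<lambda>R. map_prod Suc Suc ` rol I R \<union> {0} \<times> Suc ` E R\<rparr>"

lemma is_interp_add_root:
  assumes I: "is_interp I" and E: "\<And>R. E R \<subseteq> domain I"
  shows "is_interp (add_root I V E)"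
  unfolding is_interp_def
proof (intro conjI allI subsetI)
  show "domain (add_root I V E) \<noteq> {}" by (simp add: add_root_def)
  show "d \<in> domain (add_root I V E)" if "d \<in> conc (add_root I V E) A" for d A
    using that is_interpD[OF I] by (auto simp: add_root_def)
  show "p \<in> domain (add_root I V E) \<times> domain (add_root I V E)"
    if "p \<in> rol (add_root I V E) R" for p R
    using that is_interpD[OF I] E[of R] by (auto simp: add_root_def)
qed

lemma sem_add_root_Suc:
  assumes "is_interp I" and "d \<in> domain I"
  shows "Suc d \<in> sem (add_root I V E) C \<longleftrightarrow> d \<in> sem I C"
proof (rule sem_bounded_morphism[OF assms(1) _ _ _ assms(2)])
  show "rol (add_root I V E) R `` {Suc d} = Suc ` (rol I R `` {d})" for d R
    by (auto simp: add_root_def)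
qed (auto simp: add_root_def)

lemma sem_add_root_0:
  assumes I: "is_interp I" and E: "\<And>R. E R \<subseteq> domain I"
  shows "0 \<in> sem (add_root I V E) (concept_of_literal L) \<longleftrightarrow> root_sat I V E L"
proof -
  let ?J = "add_root I V E"
  have dom: "0 \<in> domain ?J" by (simp add: add_root_def)
  have succ: "(0, e') \<in> rol ?J R \<longleftrightarrow> (\<exists>e \<in> E R. e' = Suc e)" for e' R
    by (auto simp: add_root_def)
  have Suc: "Suc e \<in> sem ?J C \<longleftrightarrow> e \<in> sem I C" if "e \<in> E R" for e R C
    using sem_add_root_Suc[OF I] E that by blast
  show ?thesis
  proof (cases L)
    case (LEx R G)
    then show ?thesis
      by (auto simp: concept_of_literal_quant dom succ Suc simp del: concept_of_literal.simps(3,4))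
  next
    case (LAll R G)
    then show ?thesis
      by (auto simp: concept_of_literal_quant dom succ Suc simp del: concept_of_literal.simps(3,4))
  qed (auto simp: add_root_def)
qed

lemma satisfiable_if_root_sat:
  fixes I :: "('c, 'r, nat) interp"
  assumes I: "is_interp I" and E: "\<And>R. E R \<subseteq> domain I"
    and F: "\<And>CL. CL |\<in>| F \<Longrightarrow> \<exists>L |\<in>| CL. root_sat I V E L"
  shows "satisfiable F"
proof -
  have "0 \<in> domain (add_root I V E)" by (simp add: add_root_def)
  then have "0 \<in> sem (add_root I V E) (concept_of F)"
    using F by (simp add: sem_concept_of sem_add_root_0[OF I E])
  then show ?thesis
    unfolding satisfiable_def using is_interp_add_root[OF I E]
    by (intro exI[of _ "add_root I V E"]) auto
qed

text \<open>The root copies the names and successors of a satisfying element \<open>d\<close>. Since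
  \<open>d\<close> itself stays in \<open>I\<close>, edges into \<open>d\<close>, even loops, do no
  harm.\<close>

lemma satisfiable_root_satE:
  fixes F :: "('c, 'r) clause_set"
  assumes "satisfiable F"
  obtains I :: "('c, 'r, nat) interp" and V E
  where "is_interp I" and "\<And>R. E R \<subseteq> domain I"
    and "\<And>CL. CL |\<in>| F \<Longrightarrow> \<exists>L |\<in>| CL. root_sat I V E L"
proof -
  obtain I :: "('c, 'r, nat) interp" and d
    where I: "is_interp I" and d: "d \<in> sem I (concept_of F)"
    using assms unfolding satisfiable_def by blast
  let ?V = "{A. d \<in> conc I A}" and ?E = "\<lambda>R. rol I R `` {d}"
  have lit: "root_sat I ?V ?E L" if "d \<in> sem I (concept_of_literal L)" for L
    using that
    by (cases L) (auto simp: concept_of_literal_quant simp del: concept_of_literal.simps(3,4))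
  show thesis
  proof (rule that[OF I])
    show "?E R \<subseteq> domain I" for R
      using I by (auto simp: is_interp_def)
    show "\<exists>L |\<in>| CL. root_sat I ?V ?E L" if "CL |\<in>| F" for CL
      using d that lit unfolding sem_concept_of by blast
  qed
qed

section \<open>Disjoint unions of interpretations\<close>

text \<open>Even numbers code the elements of \<open>I\<close> and odd ones those of
  \<open>J\<close>; edges never change parity.\<close>

definition disjoint_union ::
  "('c, 'r, nat) interp \<Rightarrow> ('c, 'r, nat) interp \<Rightarrow> ('c, 'r, nat) interp" where
  "disjoint_union I J = \<lparr>
     domain = {n. n div 2 \<in> domain (if even n then I else J)},
     conc = \<lambda>A. {n. n div 2 \<in> conc (if even n then I else J) A},
     rol = \<lambda>R. {(m, n). even m = even n \<and> (m div 2, n div 2) \<in> rol (if even m then I else J) R}\<rparr>"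

lemma is_interp_disjoint_union:
  assumes I: "is_interp I" and J: "is_interp J"
  shows "is_interp (disjoint_union I J)"
  unfolding is_interp_def
proof (intro conjI allI subsetI)
  obtain d where "d \<in> domain I" using I by (auto simp: is_interp_def)
  then have "2 * d \<in> domain (disjoint_union I J)" by (simp add: disjoint_union_def)
  then show "domain (disjoint_union I J) \<noteq> {}" by blast
  show "d \<in> domain (disjoint_union I J)" if "d \<in> conc (disjoint_union I J) A" for d A
    using that is_interpD[OF I] is_interpD[OF J]
    by (auto simp: disjoint_union_def split: if_splits)
  show "p \<in> domain (disjoint_union I J) \<times> domain (disjoint_union I J)"
    if "p \<in> rol (disjoint_union I J) R" for p R
    using that is_interpD[OF I] is_interpD[OF J]
    by (auto simp: disjoint_union_def split: if_splits)
qed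

lemma sem_disjoint_union_left:
  assumes "is_interp I" and "d \<in> domain I"
  shows "2 * d \<in> sem (disjoint_union I J) C \<longleftrightarrow> d \<in> sem I C"
proof (rule sem_bounded_morphism[OF assms(1) _ _ _ assms(2)])
  show "rol (disjoint_union I J) R `` {2 * d} = (*) 2 ` (rol I R `` {d})" for d R
    by (auto simp: disjoint_union_def image_iff elim!: evenE)
qed (simp_all add: disjoint_union_def)

lemma sem_disjoint_union_right:
  assumes "is_interp J" and "d \<in> domain J"
  shows "2 * d + 1 \<in> sem (disjoint_union I J) C \<longleftrightarrow> d \<in> sem J C"
proof (rule sem_bounded_morphism[OF assms(1) _ _ _ assms(2)])
  show "rol (disjoint_union I J) R `` {2 * d + 1} = (\<lambda>n. 2 * n + 1) ` (rol J R `` {d})" for d R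
    by (auto simp: disjoint_union_def image_iff elim!: oddE)
qed (simp_all add: disjoint_union_def)

section \<open>Inverting the three rules\<close>

lemma sem_funion: "sem I (concept_of (F |\<union>| G)) = sem I (concept_of F) \<inter> sem I (concept_of G)"
  by (auto simp: concept_of_def)

text \<open>The unit clause \<open>{|L|}\<close> entails \<open>CL\<close>, so every model of the
  new clause set is a model of the old one.\<close>

lemma satisfiable_A1:
  assumes "satisfiable (finsert {|L|} (F |-| {|CL|}))" and "L |\<in>| CL"
  shows "satisfiable F"
proof -
  have "sem I (concept_of (finsert {|L|} (F |-| {|CL|}))) \<subseteq> sem I (concept_of F)"
    for I :: "('a, 'b, nat) interp"
    using assms(2) unfolding sem_concept_of subset_iff
    by (metis finsert_iff fminusI fsingletonD)
  then show ?thesis using assms(1) unfolding satisfiable_def by blast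
qed

lemma satisfiable_A2:
  fixes F :: "('c, 'r) clause_set"
  assumes "satisfiable (fimage (add_to_ex R F\<^sub>1) |`| ffilter (\<lambda>D. LAll R F\<^sub>1 |\<notin>| D) F)"
  shows "satisfiable F"
proof -
  obtain I :: "('c, 'r, nat) interp" and V E
    where I: "is_interp I" and E: "\<And>R. E R \<subseteq> domain I"
      and F': "\<And>D. D |\<in>| fimage (add_to_ex R F\<^sub>1) |`| ffilter (\<lambda>D. LAll R F\<^sub>1 |\<notin>| D) F \<Longrightarrow>
        \<exists>L |\<in>| D. root_sat I V E L"
    using satisfiable_root_satE[OF assms] by metis
  \<comment> \<open>Every existential restriction on \<open>R\<close> now has a witness in \<open>F\<^sub>1\<close>, so the other
    \<open>R\<close>-successors of the root can be cut off.\<close>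
  define E' where "E' = E(R := E R \<inter> sem I (concept_of F\<^sub>1))"
  have all: "root_sat I V E' (LAll R F\<^sub>1)" by (simp add: E'_def)
  \<comment> \<open>Fewer successors preserve universal literals. An existential literal on
    \<open>R\<close> keeps its witness, which lies in \<open>F\<^sub>1\<close> by
    \<open>sem_funion\<close>.\<close>
  have lit: "root_sat I V E' L" if "root_sat I V E (add_to_ex R F\<^sub>1 L)" for L
    using that by (cases L) (auto simp: E'_def sem_funion split: if_splits)
  show ?thesis
  proof (rule satisfiable_if_root_sat[OF I])
    show "E' R' \<subseteq> domain I" for R' using E[of R'] by (auto simp: E'_def)
    show "\<exists>L |\<in>| D. root_sat I V E' L" if D: "D |\<in>| F" for D
    proof (cases "LAll R F\<^sub>1 |\<in>| D")
      case True
      then show ?thesis using all by blast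
    next
      case False
      then have "add_to_ex R F\<^sub>1 |`| D |\<in>| fimage (add_to_ex R F\<^sub>1) |`| ffilter (\<lambda>D. LAll R F\<^sub>1 |\<notin>| D) F"
        using D by simp
      from F'[OF this] show ?thesis using lit by auto
    qed
  qed
qed

text \<open>A model of the child is placed beside the successors of the root and joined to it by one
  new edge. Such an edge could falsify only universal literals, and these are excluded by
  \<open>unit\<close>.\<close>

lemma satisfiable_A3:
  fixes F :: "('c, 'r) clause_set"
  assumes unit: "\<forall>D |\<in>| F.
      (\<exists>A. D = {|LPos A|}) \<or> (\<exists>A. D = {|LNeg A|}) \<or> (\<exists>R' F'. D = {|LEx R' F'|})"
    and rest: "satisfiable (F |-| {|{|LEx R F\<^sub>1|}|})" and child: "satisfiable F\<^sub>1"
  shows "satisfiable F"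
proof -
  obtain I :: "('c, 'r, nat) interp" and V E
    where I: "is_interp I" and E: "\<And>R. E R \<subseteq> domain I"
      and F': "\<And>D. D |\<in>| F |-| {|{|LEx R F\<^sub>1|}|} \<Longrightarrow> \<exists>L |\<in>| D. root_sat I V E L"
    using satisfiable_root_satE[OF rest] by metis
  obtain J :: "('c, 'r, nat) interp" and e
    where J: "is_interp J" and e: "e \<in> sem J (concept_of F\<^sub>1)"
    using child unfolding satisfiable_def by blast
  have e_dom: "e \<in> domain J" using e by (simp add: sem_concept_of)
  let ?K = "disjoint_union I J"
  \<comment> \<open>The old successors reappear as even numbers; \<open>2 * e + 1\<close> is the
    copy of the witness \<open>e\<close> for the child.\<close>
  define E' where "E' = (\<lambda>R'. (\<lambda>n. 2 * n) ` E R' \<union> {d. d = 2 * e + 1 \<and> R' = R})"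
  have ex: "root_sat ?K V E' (LEx R F\<^sub>1)"
    using e sem_disjoint_union_right[OF J e_dom] by (auto simp: E'_def)
  have lit: "root_sat ?K V E' L" if "root_sat I V E L" "\<And>R' G. L \<noteq> LAll R' G" for L
  proof (cases L)
    case (LEx R' G)
    then obtain d where d: "d \<in> E R'" "d \<in> sem I (concept_of G)" using \<open>root_sat I V E L\<close> by auto
    then have "2 * d \<in> sem ?K (concept_of G)"
      using sem_disjoint_union_left[OF I] E by blast
    then show ?thesis using LEx d(1) by (auto simp: E'_def)
  qed (use that in auto)
  have F: "\<exists>L |\<in>| D. root_sat ?K V E' L" if D: "D |\<in>| F" for D
  proof (cases "D = {|LEx R F\<^sub>1|}")
    case True
    then show ?thesis using ex by simp
  next
    case False
    then obtain L where "L |\<in>| D" "root_sat I V E L" using F'[of D] D by auto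
    moreover have "L \<noteq> LAll R' G" for R' G using unit D \<open>L |\<in>| D\<close> by fastforce
    ultimately show ?thesis using lit by blast
  qed
  have "E' R' \<subseteq> domain ?K" for R'
    using E[of R'] e_dom by (auto simp: E'_def disjoint_union_def)
  then show ?thesis
    using satisfiable_if_root_sat[OF is_interp_disjoint_union[OF I J]] F by metis
qed

text \<open>All members of \<open>S\<close> other than the one rewritten survive in
  \<open>S'\<close>; the rewritten one is recovered by inverting the rule.\<close>

lemma satisfiable_before_step:
  assumes "step S S'" and "\<forall>G \<in> S'. satisfiable G"
  shows "\<forall>G \<in> S. satisfiable G"
  using assms
proof cases
  case (A1 F CL L)
  then have "satisfiable F" using assms(2) by (intro satisfiable_A1[of L F CL]) auto
  then show ?thesis using A1 assms(2) by blast
next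
  case (A2 F CL R F\<^sub>1)
  then have "satisfiable F" using assms(2) by (intro satisfiable_A2[of R F\<^sub>1 F]) blast
  then show ?thesis using A2 assms(2) by blast
next
  case (A3 F R F\<^sub>1)
  then have "satisfiable F" using assms(2) by (intro satisfiable_A3[of F R F\<^sub>1]) auto
  then show ?thesis using A3 assms(2) by blast
qed

section \<open>Complete and clash-free families\<close>

lemma complete_clash_free_satisfiable:
  fixes F :: "('c, 'r) clause_set"
  assumes complete: "complete_family S" and clash: "clash_free S" and F: "F \<in> S"
  shows "satisfiable F"
proof -
  have no_step: "\<not> step S S'" for S' using complete by (simp add: complete_family_def)
  have unit: "\<exists>L. CL = {|L|} \<and> (\<forall>R G. L \<noteq> LAll R G)" if CL: "CL |\<in>| F" for CL
  proof -
    have "CL \<noteq> {||}" using clash F CL by (auto simp: clash_free_def)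
    then obtain L where "L |\<in>| CL" by blast
    \<comment> \<open>Inapplicability of \<open>A1\<close> forces \<open>CL = {|L|}\<close>, and
      that of \<open>A2\<close> rules out a universal \<open>L\<close>.\<close>
    then show ?thesis using step.A1[OF F CL] step.A2[OF F CL] no_step by blast
  qed
  have shape: "\<forall>D |\<in>| F.
      (\<exists>A. D = {|LPos A|}) \<or> (\<exists>A. D = {|LNeg A|}) \<or> (\<exists>R' F'. D = {|LEx R' F'|})"
  proof
    fix D
    assume "D |\<in>| F"
    then obtain L where "D = {|L|}" "\<forall>R G. L \<noteq> LAll R G" using unit by blast
    then show "(\<exists>A. D = {|LPos A|}) \<or> (\<exists>A. D = {|LNeg A|}) \<or> (\<exists>R' F'. D = {|LEx R' F'|})"
      by (cases L) auto
  qed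
  \<comment> \<open>This interpretation is a mere placeholder: the model is a root without
    successors, where exactly the names in positive unit clauses hold.\<close>
  let ?I = "\<lparr>domain = {0}, conc = \<lambda>_. {}, rol = \<lambda>_. {}\<rparr> :: ('c, 'r, nat) interp"
  let ?V = "{A. {|LPos A|} |\<in>| F}"
  have "\<exists>L |\<in>| D. root_sat ?I ?V (\<lambda>_. {}) L" if D: "D |\<in>| F" for D
  proof -
    \<comment> \<open>By \<open>shape\<close> the side condition of \<open>A3\<close> is met, so any
      existential unit clause would permit a step.\<close>
    have "D \<noteq> {|LEx R G|}" for R G using step.A3[OF F shape] D no_step by blast
    then consider A where "D = {|LPos A|}" | A where "D = {|LNeg A|}"
      using bspec[OF shape D] by metis
    then show ?thesis
    proof cases
      case (2 A)
      then have "{|LPos A|} |\<notin>| F"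
        using clash F D unfolding clash_free_def by (metis complement.simps(1))
      with 2 show ?thesis by simp
    qed (use D in simp)
  qed
  moreover have "is_interp ?I" by (simp add: is_interp_def)
  ultimately show ?thesis
    by (intro satisfiable_if_root_sat[of ?I "\<lambda>_. {}" F ?V]) simp_all
qed

theorem mainTheorem3:
  fixes F :: "('c, 'r) clause_set" and S :: "('c, 'r) clause_set set"
  assumes "step\<^sup>*\<^sup>* {F} S" and "complete_family S" and "clash_free S"
  shows "satisfiable F"
proof -
  have "\<forall>G \<in> S. satisfiable G"
    using complete_clash_free_satisfiable[OF assms(2,3)] by blast
  \<comment> \<open>Satisfiability of all members is carried backwards from the final family to the
    initial one.\<close>
  with assms(1) have "\<forall>G \<in> {F}. satisfiable G"
    by (induction rule: converse_rtranclp_induct) (use satisfiable_before_step in blast)+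
  then show ?thesis by simp
qed

end
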